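(* Let $M:\mathbb{R}^{n_1\times n_2\times n_3}\to\mathbb{R}^{N_1\times N_2}$ be a linear map. Suppose that for some $r\ge1$ and generically chosen components $a^{(\ell)}\in\mathbb{R}^{n_1},b^{(\ell)}\in\mathbb{R}^{n_2},c^{(\ell)}\in\mathbb{R}^{n_3}$ ($\ell\in[r]$), $$\mathrm{rank}\Big(M\Big(\sum_{\ell=1}^r a^{(\ell)}\otimes b^{(\ell)}\otimes c^{(\ell)}\Big)\Big)=r\cdot\mathrm{rank}\big(M(a^{(1)}\otimes b^{(1)}\otimes c^{(1)})\big).$$ Then $r\le 2(n_1+n_2+n_3+1)$.
   Context: "Generically chosen" means: the identity holds for all choices of the components outside the zero set of some nonidentically-zero polynomial in all coordinates of the components.
   Formalization: The linear map M is additionally assumed not to be the zero map; for M = 0 both sides of the rank identity vanish for every r, so the statement as written would be false. *)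

theory Defs
  imports "HOL-Analysis.Analysis"
begin

definition outer3 :: "real ^ 'n1 \<Rightarrow> real ^ 'n2 \<Rightarrow> real ^ 'n3 \<Rightarrow> real ^ 'n3 ^ 'n2 ^ 'n1" where
  "outer3 a b c = (\<chi> i j k. a $ i * b $ j * c $ k)"

text \<open>On a Euclidean space, \<open>real_polynomial_function\<close> describes exactly the functions that are
  polynomials in the coordinates; over the reals a polynomial is nonzero iff the function it
  induces is not identically zero.\<close>

definition generically :: "('a::euclidean_space \<Rightarrow> bool) \<Rightarrow> bool" where
  "generically P \<longleftrightarrow>
     (\<exists>p. real_polynomial_function p \<and> (\<exists>x. p x \<noteq> 0) \<and> (\<forall>x. p x \<noteq> 0 \<longrightarrow> P x))"

end

theory Submission
  imports Defs
begin

text \<open>Write \<open>X(x) = M(a \<otimes> b \<otimes> c)\<close> for \<open>x = (a, b, c)\<close>, and let \<open>x\<^sub>0\<close> be a point where the rank of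
  \<open>X\<close> is locally maximal, say \<open>k\<close>. Expand \<open>X(x\<^sub>0 + y) = A + E\<^sub>1 + E\<^sub>2 + E\<^sub>3\<close> by degree in \<open>y\<close>, let \<open>G\<close> be
  a generalized inverse of \<open>A\<close> of rank at most \<open>k\<close>, and put \<open>Q = I - AG\<close>, \<open>P = I - GA\<close>. Comparing
  coefficients in the vanishing Schur complement of \<open>X(x\<^sub>0 + t y)\<close> up to order \<open>t\<^sup>3\<close> gives
  \<open>Q X P = Q E\<^sub>1 G (E\<^sub>1 + E\<^sub>2 - E\<^sub>1 G E\<^sub>1) P + Q E\<^sub>2 G E\<^sub>1 P\<close>. As \<open>E\<^sub>1\<close> is linear in \<open>y\<close>, it is a
  combination of \<open>n = n\<^sub>1 + n\<^sub>2 + n\<^sub>3\<close> fixed matrices, so any sum of values of \<open>Q X P\<close>, with however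
  many terms, has rank at most \<open>2 n k\<close>. The remaining blocks contribute at most \<open>2 k\<close>, hence every sum
  of values of \<open>X\<close> has rank at most \<open>2 (n + 1) k\<close>, while the hypothesis makes a generic one with
  \<open>r\<close> terms have rank \<open>r k\<close>.\<close>

section \<open>Rank inequalities and generalized inverses\<close>

lemma rank_add_le:
  fixes A B :: "real ^ 'n ^ 'm"
  shows "rank (A + B) \<le> rank A + rank B"
proof -
  have "dim (range ((*v) (A + B))) \<le> dim {x + y |x y. x \<in> range ((*v) A) \<and> y \<in> range ((*v) B)}"
    by (rule dim_subset) (auto simp: matrix_vector_mult_add_rdistrib)
  also have "\<dots> \<le> dim (range ((*v) A)) + dim (range ((*v) B))"
    using dim_sums_Int[of "range ((*v) A)" "range ((*v) B)"]
    by (simp add: linear_subspace_image)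
  finally show ?thesis
    by (simp add: rank_dim_range)
qed

lemma rank_sum_le:
  fixes A :: "'i \<Rightarrow> real ^ 'n ^ 'm"
  assumes "\<And>i. i \<in> I \<Longrightarrow> rank (A i) \<le> k"
  shows "rank (\<Sum>i\<in>I. A i) \<le> card I * k"
  using assms
proof (induction I rule: infinite_finite_induct)
  case (insert i I)
  have "rank (\<Sum>i\<in>insert i I. A i) \<le> rank (A i) + rank (\<Sum>i\<in>I. A i)"
    using insert.hyps rank_add_le[of "A i"] by simp
  also have "\<dots> \<le> k + card I * k"
    using insert by (intro add_mono) auto
  finally show ?case
    using insert.hyps by simp
qed auto

text \<open>The kernel is the orthogonal complement of the row space, whose dimension is the
  rank.\<close>

lemma rank_plus_dim_kernel:
  fixes A :: "real ^ 'n ^ 'm"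
  shows "rank A + dim {v. A *v v = 0} = CARD('n)"
proof -
  have "{v. A *v v = 0} = {v \<in> UNIV. \<forall>x\<in>span (rows A). orthogonal x v}"
  proof (intro set_eqI iffI)
    fix v assume "v \<in> {v. A *v v = 0}"
    then have "\<forall>x\<in>rows A. orthogonal v x"
      by (auto simp: rows_def row_def orthogonal_def vec_eq_iff matrix_vector_mult_def
          inner_vec_def mult.commute)
    then show "v \<in> {v \<in> UNIV. \<forall>x\<in>span (rows A). orthogonal x v}"
      using orthogonal_to_span orthogonal_commute by blast
  next
    fix v assume "v \<in> {v \<in> UNIV. \<forall>x\<in>span (rows A). orthogonal x v}"
    then have "orthogonal (row i A) v" for i
      by (auto simp: rows_def intro: span_base)
    then show "v \<in> {v. A *v v = 0}"
      by (auto simp: row_def orthogonal_def vec_eq_iff matrix_vector_mult_def inner_vec_def)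
  qed
  then show ?thesis
    using dim_subspace_orthogonal_to_vectors[of "span (rows A)" "UNIV :: (real ^ 'n) set"]
    by (simp add: row_rank_def)
qed

text \<open>A linear right inverse \<open>g\<close> of \<open>A\<close> on its range gives the
  identity; passing to \<open>g A g\<close> preserves it and caps the rank. That cap is what later
  makes every product through \<open>G\<close> cost at most \<open>rank A\<close>.\<close>

lemma generalized_inverse_exists:
  fixes A :: "real ^ 'n ^ 'm"
  obtains G :: "real ^ 'm ^ 'n" where "A ** G ** A = A" "rank G \<le> rank A"
proof -
  obtain g where g: "linear g" "\<And>v. A *v g (A *v v) = A *v v"
    using linear_exists_right_inverse_on[of "(*v) A" UNIV] by (auto simp: subspace_UNIV)
  have AGA: "A ** matrix g ** A = A"
    using g by (simp add: matrix_eq flip: matrix_vector_mul_assoc)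
  show ?thesis
  proof
    show "A ** (matrix g ** A ** matrix g) ** A = A"
      by (metis AGA matrix_mul_assoc)
    show "rank (matrix g ** A ** matrix g) \<le> rank A"
      by (meson order_trans rank_mul_le_left rank_mul_le_right)
  qed
qed

section \<open>Lifting kernel vectors along a curve of matrices\<close>

text \<open>Kernel form of the vanishing Schur complement: the rank condition becomes a lift of each
  kernel vector of \<open>A\<close>, normalized so that \<open>w\<close> can be compared with
  \<open>v\<close>.\<close>

lemma kernel_perturbation:
  fixes A E :: "real ^ 'n ^ 'm" and G :: "real ^ 'm ^ 'n"
  assumes G: "A ** G ** A = A"
    and rank: "rank (A + E) \<le> rank A"
    and inj: "\<And>w. w + G *v (E *v w) = 0 \<Longrightarrow> w = 0"
    and v: "A *v v = 0"
  obtains w where "A *v w + E *v w = 0" "w + G *v (E *v w) = v"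
proof -
  \<comment> \<open>\<open>T\<close> maps the kernel of \<open>A + E\<close> injectively into that of \<open>A\<close>, and the rank hypothesis
    makes the dimensions agree.\<close>
  define T where "T w = w + G *v (E *v w)" for w
  have T: "linear T"
    unfolding T_def by (intro linearI)
      (simp_all add: matrix_vector_right_distrib matrix_vector_mult_scaleR scaleR_add_right)
  have inj_T: "inj T"
    unfolding linear_injective_0[OF T] T_def using inj by blast
  define K where "K = {w. (A + E) *v w = 0}"
  have K: "subspace K"
    unfolding K_def by (rule linear_subspace_kernel) (rule matrix_vector_mul_linear)
  have AGA: "A *v (G *v (A *v x)) = A *v x" for x
    using arg_cong[OF G, of "\<lambda>B. B *v x"] by (simp flip: matrix_vector_mul_assoc)
  have "T ` K \<subseteq> {v. A *v v = 0}"
  proof clarsimp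
    fix w assume "w \<in> K"
    then have "E *v w = - (A *v w)"
      by (simp add: K_def matrix_vector_mult_add_rdistrib add_eq_0_iff)
    then show "A *v T w = 0"
      using AGA[of w] by (simp add: T_def vec.neg vec.diff)
  qed
  moreover have "dim {v. A *v v = 0} \<le> dim (T ` K)"
  proof -
    have "dim (T ` K) = dim K"
      by (intro dim_image_eq T inj_on_subset[OF inj_T]) simp
    then show ?thesis
      using rank rank_plus_dim_kernel[of A] rank_plus_dim_kernel[of "A + E"] by (simp add: K_def)
  qed
  ultimately have "T ` K = {v. A *v v = 0}"
    by (intro subspace_dim_equal linear_subspace_image T K linear_subspace_kernel
        matrix_vector_mul_linear)
  moreover have "v \<in> {v. A *v v = 0}"
    using v by simp
  ultimately obtain w where w: "w \<in> K" "T w = v"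
    by (metis imageE)
  show ?thesis
  proof (rule that)
    show "A *v w + E *v w = 0"
      using w(1) by (simp add: K_def matrix_vector_mult_add_rdistrib)
    show "w + G *v (E *v w) = v"
      using w(2) by (simp add: T_def)
  qed
qed

lemma tendsto_matrix_vector_mult:
  fixes A :: "real ^ 'n ^ 'm"
  assumes "(f \<longlongrightarrow> v) F"
  shows "((\<lambda>t. A *v f t) \<longlongrightarrow> A *v v) F"
  using matrix_vector_mul_bounded_linear assms by (rule bounded_linear.tendsto)

text \<open>For each small \<open>t\<close> the perturbation is too small to destroy injectivity, so
  a lift exists. The lifts are chosen pointwise, without any regularity in \<open>t\<close>;
  convergence follows because the normalization forces \<open>w t - v\<close> to be of order
  \<open>t\<close>.\<close>

lemma kernel_curve_exists:
  fixes A E1 E2 E3 :: "real ^ 'n ^ 'm" and G :: "real ^ 'm ^ 'n"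
  assumes G: "A ** G ** A = A"
    and rank: "\<forall>\<^sub>F t in at_right 0.
      rank (A + t *\<^sub>R (E1 + t *\<^sub>R E2 + t\<^sup>2 *\<^sub>R E3)) \<le> rank A"
    and v: "A *v v = 0"
  obtains w where "(w \<longlongrightarrow> v) (at_right 0)"
    "\<forall>\<^sub>F t in at_right 0. A *v w t + t *\<^sub>R ((E1 + t *\<^sub>R E2 + t\<^sup>2 *\<^sub>R E3) *v w t) = 0"
    "\<forall>\<^sub>F t in at_right 0. w t + t *\<^sub>R (G *v ((E1 + t *\<^sub>R E2 + t\<^sup>2 *\<^sub>R E3) *v w t)) = v"
proof -
  define F where "F t = E1 + t *\<^sub>R E2 + t\<^sup>2 *\<^sub>R E3" for t :: real
  \<comment> \<open>Bounds the operator norm of \<open>G ** F t\<close> uniformly for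
    \<open>0 < t < 1\<close>; the \<open>+ 1\<close> makes it positive, so that it may be divided
    by.\<close>
  define C where "C = onorm ((*v) (G ** E1)) + onorm ((*v) (G ** E2)) + onorm ((*v) (G ** E3)) + 1"
  have on: "0 \<le> onorm ((*v) (G ** B))" "norm (G *v (B *v x)) \<le> onorm ((*v) (G ** B)) * norm x"
    for B :: "real ^ 'n ^ 'm" and x
    using onorm[OF matrix_vector_mul_bounded_linear, of "G ** B" x]
    by (simp_all add: onorm_pos_le matrix_vector_mul_bounded_linear matrix_vector_mul_assoc)
  have C: "C > 0"
    using on(1)[of E1] on(1)[of E2] on(1)[of E3] by (simp add: C_def)
  have bound: "norm (G *v (F t *v x)) \<le> C * norm x" if "0 < t" "t < 1" for t x
  proof -
    have "norm (G *v (F t *v x)) =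
        norm (G *v (E1 *v x) + t *\<^sub>R (G *v (E2 *v x)) + t\<^sup>2 *\<^sub>R (G *v (E3 *v x)))"
      by (simp add: F_def matrix_vector_mult_add_rdistrib matrix_vector_right_distrib
          matrix_vector_mult_scaleR flip: scaleR_matrix_vector_assoc)
    also have "\<dots> \<le> norm (G *v (E1 *v x)) + t * norm (G *v (E2 *v x)) + t\<^sup>2 * norm (G *v (E3 *v x))"
      using that by (intro norm_triangle_le add_mono order_refl) simp_all
    also have "\<dots> \<le> norm (G *v (E1 *v x)) + norm (G *v (E2 *v x)) + norm (G *v (E3 *v x))"
      using that by (intro add_mono order_refl mult_left_le_one_le) (simp_all add: power_le_one)
    also have "\<dots> \<le> C * norm x"
      using on(2)[of E1 x] on(2)[of E2 x] on(2)[of E3 x] norm_ge_zero[of x]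
      unfolding C_def distrib_right mult_1 by linarith
    finally show ?thesis .
  qed
  \<comment> \<open>The bound \<open>1 / 2\<close> serves twice: being below 1 it gives injectivity,
    and it lets half of \<open>norm (w t)\<close> be absorbed, whence \<open>norm (w t)\<close> is
    at most \<open>2 * norm v\<close>.\<close>
  have small: "\<forall>\<^sub>F t in at_right 0. 0 < t \<and> t < 1 \<and> t * C < 1 / 2"
  proof -
    have "\<forall>\<^sub>F t in at_right 0. t \<in> {0<..<min 1 (1 / (2 * C))}"
      using C by (intro eventually_at_right_real) simp
    then show ?thesis
      by eventually_elim (use C in \<open>auto simp: field_simps\<close>)
  qed
  have shift: "norm (t *\<^sub>R (G *v (F t *v x))) \<le> t * C * norm x"
    if "0 < t" "t < 1" for t x
    using bound[OF that, of x] that by simp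
  have "\<forall>\<^sub>F t in at_right 0. \<exists>w. A *v w + t *\<^sub>R (F t *v w) = 0 \<and> w + t *\<^sub>R (G *v (F t *v w)) = v"
    using small rank
  proof eventually_elim
    case (elim t)
    have "w = 0" if "w + G *v ((t *\<^sub>R F t) *v w) = 0" for w
    proof (rule ccontr)
      assume "w \<noteq> 0"
      have "w + t *\<^sub>R (G *v (F t *v w)) = 0"
        using that by (simp add: matrix_vector_mult_scaleR flip: scaleR_matrix_vector_assoc)
      then have "norm w = norm (t *\<^sub>R (G *v (F t *v w)))"
        by (metis add_eq_0_iff norm_minus_cancel)
      also have "\<dots> \<le> t * C * norm w"
        using shift elim by blast
      also have "\<dots> < norm w"
        using elim \<open>w \<noteq> 0\<close> by simp
      finally show False by simp
    qed
    then obtain w where "A *v w + (t *\<^sub>R F t) *v w = 0" "w + G *v ((t *\<^sub>R F t) *v w) = v"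
      using kernel_perturbation[OF G _ _ v, of "t *\<^sub>R F t"] elim unfolding F_def by blast
    then show ?case
      by (auto simp: matrix_vector_mult_scaleR simp flip: scaleR_matrix_vector_assoc)
  qed
  then obtain w where w: "\<forall>\<^sub>F t in at_right 0. A *v w t + t *\<^sub>R (F t *v w t) = 0
      \<and> w t + t *\<^sub>R (G *v (F t *v w t)) = v"
    unfolding eventually_ex by blast
  have "\<forall>\<^sub>F t in at_right 0. norm (w t - v) \<le> t * (2 * C * norm v)"
    using w small
  proof eventually_elim
    case (elim t)
    then have "norm (w t - v) = norm (t *\<^sub>R (G *v (F t *v w t)))"
      by (metis add_diff_cancel_left' norm_minus_commute)
    then have *: "norm (w t - v) \<le> t * C * norm (w t)"
      using shift elim by simp
    also have "\<dots> \<le> 1 / 2 * norm (w t)"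
      using elim by (intro mult_right_mono) auto
    finally have "norm (w t) \<le> 2 * norm v"
      using norm_triangle_sub[of "w t" v] by simp
    then have "t * C * norm (w t) \<le> t * C * (2 * norm v)"
      using elim C by (intro mult_left_mono) auto
    with * show ?case by simp
  qed
  moreover have "((\<lambda>t. t * (2 * C * norm v)) \<longlongrightarrow> 0) (at_right 0)"
    by (auto intro!: tendsto_eq_intros)
  ultimately have "((\<lambda>t. w t - v) \<longlongrightarrow> 0) (at_right 0)"
    by (rule Lim_null_comparison)
  then have "(w \<longlongrightarrow> v) (at_right 0)"
    by (simp add: LIM_zero_iff)
  then show ?thesis
    using that w unfolding F_def by (simp add: eventually_conj_iff)
qed

text \<open>Along the kernel curve \<open>w\<close> one has \<open>Q *v (E1 + t E2 + t\<^sup>2 E3) *v w = 0\<close>. Substituting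
  \<open>w = v - t g\<close> and dividing by \<open>t\<close> twice, the limits \<open>t \<rightarrow> 0\<close> express \<open>Q *v E\<^sub>j *v v\<close>
  for \<open>j = 1, 2, 3\<close> in turn.\<close>

lemma cubic_curve_relation:
  fixes A E1 E2 E3 :: "real ^ 'n ^ 'm" and G :: "real ^ 'm ^ 'n"
  assumes G: "A ** G ** A = A"
    and rank: "\<forall>\<^sub>F t in at_right 0.
      rank (A + t *\<^sub>R (E1 + t *\<^sub>R E2 + t\<^sup>2 *\<^sub>R E3)) \<le> rank A"
    and v: "A *v v = 0"
  defines "Q \<equiv> mat 1 - A ** G"
  shows "Q *v ((A + E1 + E2 + E3) *v v) =
    Q *v (E1 *v (G *v ((E1 + E2 - E1 ** G ** E1) *v v))) + Q *v (E2 *v (G *v (E1 *v v)))"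
proof -
  note lin = matrix_vector_mult_add_rdistrib matrix_vector_mult_diff_rdistrib
    matrix_vector_right_distrib vec.diff matrix_vector_mult_scaleR
  obtain w where w: "(w \<longlongrightarrow> v) (at_right 0)"
    and ker: "\<forall>\<^sub>F t in at_right 0. A *v w t + t *\<^sub>R ((E1 + t *\<^sub>R E2 + t\<^sup>2 *\<^sub>R E3) *v w t) = 0"
    and fix_v: "\<forall>\<^sub>F t in at_right 0. w t + t *\<^sub>R (G *v ((E1 + t *\<^sub>R E2 + t\<^sup>2 *\<^sub>R E3) *v w t)) = v"
    using kernel_curve_exists[OF G rank v] by blast
  define g where "g t = G *v (E1 *v w t) + t *\<^sub>R (G *v (E2 *v w t)) + t\<^sup>2 *\<^sub>R (G *v (E3 *v w t))" for t
  have g_alt: "g t = G *v ((E1 + t *\<^sub>R E2 + t\<^sup>2 *\<^sub>R E3) *v w t)" for t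
    by (simp add: g_def lin flip: scaleR_matrix_vector_assoc)
  have t: "((\<lambda>t::real. t) \<longlongrightarrow> 0) (at_right 0)"
    by simp
  have t2: "((\<lambda>t::real. t\<^sup>2) \<longlongrightarrow> 0) (at_right 0)"
    using tendsto_power[OF t, of 2] by simp
  have tw: "((\<lambda>t. t *\<^sub>R (B *v w t)) \<longlongrightarrow> 0) (at_right 0)"
    "((\<lambda>t. t\<^sup>2 *\<^sub>R (B *v w t)) \<longlongrightarrow> 0) (at_right 0)" for B :: "real ^ 'n ^ 'k"
    using tendsto_scaleR[OF t tendsto_matrix_vector_mult[OF w, of B]]
      tendsto_scaleR[OF t2 tendsto_matrix_vector_mult[OF w, of B]] by simp_all
  have g: "(g \<longlongrightarrow> G *v (E1 *v v)) (at_right 0)"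
    unfolding g_def
    using tendsto_add[OF tendsto_add[OF tendsto_matrix_vector_mult[OF w, of "G ** E1"] tw(1)[of "G ** E2"]]
        tw(2)[of "G ** E3"]]
    by (simp flip: matrix_vector_mul_assoc)
  have pos: "\<forall>\<^sub>F t in at_right 0. (0::real) < t"
    by (rule eventually_at_right_less)
  have lim_eq: "l = 0" if "(f \<longlongrightarrow> l) (at_right 0)" "\<forall>\<^sub>F t in at_right 0. f t = 0"
    for f :: "real \<Rightarrow> real ^ 'm" and l
    using tendsto_unique[OF _ that(1) tendsto_eventually[OF that(2)]] by simp
  have QA: "Q *v (A *v x) = 0" for x
    using G by (simp add: Q_def lin) (simp add: matrix_vector_mul_assoc)
  have w_eq: "\<forall>\<^sub>F t in at_right 0. w t = v - t *\<^sub>R g t"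
    using fix_v by eventually_elim (simp add: g_alt algebra_simps)

  have 1: "\<forall>\<^sub>F t in at_right 0.
      Q *v (E1 *v w t) + t *\<^sub>R (Q *v (E2 *v w t)) + t\<^sup>2 *\<^sub>R (Q *v (E3 *v w t)) = 0"
    using ker pos
  proof eventually_elim
    case (elim t)
    have "Q *v (A *v w t + t *\<^sub>R ((E1 + t *\<^sub>R E2 + t\<^sup>2 *\<^sub>R E3) *v w t)) = 0"
      by (simp only: elim(1)) simp
    then have "t *\<^sub>R (Q *v ((E1 + t *\<^sub>R E2 + t\<^sup>2 *\<^sub>R E3) *v w t)) = 0"
      by (simp only: lin QA add_0_left)
    then show ?case
      using elim(2) by (simp add: lin flip: scaleR_matrix_vector_assoc)
  qed
  have Q1: "Q *v (E1 *v v) = 0"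
    by (rule lim_eq[OF _ 1])
      (use tendsto_add[OF tendsto_add[OF tendsto_matrix_vector_mult[OF w, of "Q ** E1"]
        tw(1)[of "Q ** E2"]] tw(2)[of "Q ** E3"]]
        in \<open>simp flip: matrix_vector_mul_assoc\<close>)

  have 2: "\<forall>\<^sub>F t in at_right 0.
      Q *v (E2 *v w t) + t *\<^sub>R (Q *v (E3 *v w t)) - Q *v (E1 *v g t) = 0"
    using 1 w_eq pos
  proof eventually_elim
    case (elim t)
    have "Q *v (E1 *v w t) = - t *\<^sub>R (Q *v (E1 *v g t))"
      using Q1 by (subst elim(2)) (simp add: lin)
    then have "t *\<^sub>R (Q *v (E2 *v w t) + t *\<^sub>R (Q *v (E3 *v w t)) - Q *v (E1 *v g t)) = 0"
      using elim(1) by (simp add: algebra_simps power2_eq_square)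
    then show ?case
      using elim(3) by simp
  qed
  have Q2: "Q *v (E2 *v v) - Q *v (E1 *v (G *v (E1 *v v))) = 0"
    by (rule lim_eq[OF _ 2])
      (use tendsto_diff[OF tendsto_add[OF tendsto_matrix_vector_mult[OF w, of "Q ** E2"]
        tw(1)[of "Q ** E3"]] tendsto_matrix_vector_mult[OF g, of "Q ** E1"]]
        in \<open>simp flip: matrix_vector_mul_assoc\<close>)

  \<comment> \<open>In \<open>2\<close>, first expand \<open>g t\<close> by its definition, then
    substitute \<open>w t = v - t *\<^sub>R g t\<close> in the terms of order 0. Their values at
    \<open>v\<close> cancel by \<open>Q2\<close>, so another factor \<open>t\<close> can be divided
    out.\<close>
  have 3: "\<forall>\<^sub>F t in at_right 0.
      Q *v (E3 *v w t) - Q *v (E1 *v (G *v (E2 *v w t))) - t *\<^sub>R (Q *v (E1 *v (G *v (E3 *v w t))))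
        - Q *v (E2 *v g t) + Q *v (E1 *v (G *v (E1 *v g t))) = 0"
    using 2 w_eq pos
  proof eventually_elim
    case (elim t)
    have "Q *v (E2 *v w t) - Q *v (E1 *v (G *v (E1 *v w t)))
        = t *\<^sub>R (Q *v (E1 *v (G *v (E1 *v g t))) - Q *v (E2 *v g t))"
      using Q2 by (subst (1 2) elim(2)) (simp add: lin algebra_simps)
    moreover have "Q *v (E1 *v g t) = Q *v (E1 *v (G *v (E1 *v w t)))
        + t *\<^sub>R (Q *v (E1 *v (G *v (E2 *v w t)))) + t\<^sup>2 *\<^sub>R (Q *v (E1 *v (G *v (E3 *v w t))))"
      by (simp add: g_def lin)
    then have "t *\<^sub>R (Q *v (E3 *v w t) - Q *v (E1 *v (G *v (E2 *v w t)))
        - t *\<^sub>R (Q *v (E1 *v (G *v (E3 *v w t))))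
        - Q *v (E2 *v g t) + Q *v (E1 *v (G *v (E1 *v g t))))
      = (Q *v (E2 *v w t) + t *\<^sub>R (Q *v (E3 *v w t)) - Q *v (E1 *v g t))
        - ((Q *v (E2 *v w t) - Q *v (E1 *v (G *v (E1 *v w t))))
          - t *\<^sub>R (Q *v (E1 *v (G *v (E1 *v g t))) - Q *v (E2 *v g t)))"
      by (simp add: algebra_simps power2_eq_square)
    ultimately have "t *\<^sub>R (Q *v (E3 *v w t) - Q *v (E1 *v (G *v (E2 *v w t)))
        - t *\<^sub>R (Q *v (E1 *v (G *v (E3 *v w t))))
        - Q *v (E2 *v g t) + Q *v (E1 *v (G *v (E1 *v g t)))) = 0"
      using elim(1) by (simp only: diff_self)
    then show ?case
      using elim(3) by simp
  qed
  have Q3: "Q *v (E3 *v v) - Q *v (E1 *v (G *v (E2 *v v)))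
      - Q *v (E2 *v (G *v (E1 *v v))) + Q *v (E1 *v (G *v (E1 *v (G *v (E1 *v v))))) = 0"
    by (rule lim_eq[OF _ 3])
      (use tendsto_add[OF tendsto_diff[OF tendsto_diff[OF tendsto_diff[OF
        tendsto_matrix_vector_mult[OF w, of "Q ** E3"]
        tendsto_matrix_vector_mult[OF w, of "Q ** E1 ** G ** E2"]]
        tw(1)[of "Q ** E1 ** G ** E3"]]
        tendsto_matrix_vector_mult[OF g, of "Q ** E2"]]
        tendsto_matrix_vector_mult[OF g, of "Q ** E1 ** G ** E1"]]
        in \<open>simp flip: matrix_vector_mul_assoc\<close>)
  \<comment> \<open>The three limits are added, and \<open>Q *v (A *v v)\<close> vanishes.\<close>
  show ?thesis
    using Q1 Q2 Q3 QA[of v]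
    by (simp add: lin algebra_simps flip: matrix_vector_mul_assoc)
qed

section \<open>Rank of sums of values of a cubic map\<close>

lemma matrix_vector_mult_sum_left:
  fixes A :: "'i \<Rightarrow> real ^ 'n ^ 'm"
  shows "(\<Sum>i\<in>I. A i) *v v = (\<Sum>i\<in>I. A i *v v)"
  by (induction I rule: infinite_finite_induct) (auto simp: matrix_vector_mult_add_rdistrib)

text \<open>The factor 2 counts the blocks \<open>A G S\<close> and \<open>Q S G A\<close>, and
  \<open>2 * DIM('a)\<close> counts one product through \<open>G\<close> per basis vector for
  \<open>E1\<close> on the left and for \<open>E1\<close> on the right.\<close>

lemma rank_sum_of_cubic_values_le:
  fixes X E1 E2 E3 :: "'a::euclidean_space \<Rightarrow> real ^ 'n ^ 'm"
  assumes lin1: "linear E1"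
    and expand: "\<And>y t. X (x0 + t *\<^sub>R y) =
      X x0 + t *\<^sub>R (E1 y + t *\<^sub>R E2 y + t\<^sup>2 *\<^sub>R E3 y)"
    and rank: "\<And>y. \<forall>\<^sub>F t in at_right 0. rank (X (x0 + t *\<^sub>R y)) \<le> rank (X x0)"
  shows "rank (\<Sum>l\<in>L. X (x l)) \<le> 2 * (DIM('a) + 1) * rank (X x0)"
proof -
  note lin = matrix_vector_mult_add_rdistrib matrix_vector_mult_diff_rdistrib
    matrix_vector_right_distrib vec.diff matrix_vector_mult_scaleR
  define A where "A = X x0"
  obtain G where G: "A ** G ** A = A" and rank_G: "rank G \<le> rank A"
    using generalized_inverse_exists by blast
  define Q where "Q = mat 1 - A ** G"
  define P where "P = mat 1 - G ** A"
  define y where "y l = x l - x0" for l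
  define Z where "Z l = E1 (y l) + E2 (y l) - E1 (y l) ** G ** E1 (y l)" for l
  define S where "S = (\<Sum>l\<in>L. X (x l))"
  \<comment> \<open>\<open>U i\<close> and \<open>W i\<close> absorb all dependence on
    \<open>l\<close>: after \<open>E1 (y l)\<close> is expanded in the basis, the factors left over
    are fixed matrices, so the sum over \<open>l\<close> creates no new terms.\<close>
  define U where "U i = (\<Sum>l\<in>L. (y l \<bullet> i) *\<^sub>R (Z l ** P))" for i
  define W where "W i = (\<Sum>l\<in>L. (y l \<bullet> i) *\<^sub>R (Q ** E2 (y l)))" for i
  have X: "X (x l) = A + E1 (y l) + E2 (y l) + E3 (y l)" for l
    using expand[of 1 "y l"] by (simp add: A_def y_def add.assoc)
  have AP: "A *v (P *v u) = 0" for u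
    using G by (simp add: P_def lin) (simp add: matrix_vector_mul_assoc matrix_mul_assoc)
  have E1_eq: "E1 (y l) *v u = (\<Sum>i\<in>Basis. (y l \<bullet> i) *\<^sub>R (E1 i *v u))" for l u
  proof -
    have "E1 (y l) = (\<Sum>i\<in>Basis. (y l \<bullet> i) *\<^sub>R E1 i)"
      by (subst euclidean_representation[of "y l", symmetric])
        (simp only: linear_sum[OF lin1] linear_scale[OF lin1])
    then show ?thesis
      by (simp add: matrix_vector_mult_sum_left scaleR_matrix_vector_assoc)
  qed
  have QXP: "Q *v (X (x l) *v (P *v u)) =
      (\<Sum>i\<in>Basis. (y l \<bullet> i) *\<^sub>R (Q *v (E1 i *v (G *v (Z l *v (P *v u))))))
      + (\<Sum>i\<in>Basis. (y l \<bullet> i) *\<^sub>R (Q *v (E2 (y l) *v (G *v (E1 i *v (P *v u))))))" for l u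
  proof -
    have "\<forall>\<^sub>F t in at_right 0.
        rank (A + t *\<^sub>R (E1 (y l) + t *\<^sub>R E2 (y l) + t\<^sup>2 *\<^sub>R E3 (y l))) \<le> rank A"
      using rank[of "y l"] by (simp add: expand A_def)
    from cubic_curve_relation[OF G this AP]
    have "Q *v (X (x l) *v (P *v u)) = Q *v (E1 (y l) *v (G *v (Z l *v (P *v u))))
        + Q *v (E2 (y l) *v (G *v (E1 (y l) *v (P *v u))))"
      by (simp only: X Q_def Z_def)
    then show ?thesis
      by (simp add: E1_eq vec.sum matrix_vector_mult_scaleR)
  qed
  \<comment> \<open>From \<open>A G + Q = I\<close> and \<open>G A + P = I\<close>,
    \<open>S = A G S + Q S G A + Q S P\<close>; the last block is rewritten by
    \<open>QXP\<close>.\<close>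
  have decomposition: "S = A ** (G ** S) + Q ** S ** G ** A
      + (\<Sum>i\<in>Basis. Q ** E1 i ** G ** U i) + (\<Sum>i\<in>Basis. W i ** (G ** (E1 i ** P)))"
  proof (unfold matrix_eq, rule allI)
    fix u
    have "Q *v (S *v (P *v u)) = (\<Sum>l\<in>L. Q *v (X (x l) *v (P *v u)))"
      by (simp add: S_def matrix_vector_mult_sum_left vec.sum)
    also have "\<dots> = (\<Sum>i\<in>Basis. (Q ** E1 i ** G ** U i) *v u)
        + (\<Sum>i\<in>Basis. (W i ** (G ** (E1 i ** P))) *v u)"
      unfolding QXP sum.distrib
      by (subst (1 2) sum.swap)
        (simp add: U_def W_def matrix_vector_mult_sum_left vec.sum matrix_vector_mult_scaleR
          flip: matrix_vector_mul_assoc scaleR_matrix_vector_assoc)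
    finally have QSP: "Q *v (S *v (P *v u)) = (\<Sum>i\<in>Basis. (Q ** E1 i ** G ** U i) *v u)
        + (\<Sum>i\<in>Basis. (W i ** (G ** (E1 i ** P))) *v u)" .
    have "S *v u = A *v (G *v (S *v u)) + Q *v (S *v (G *v (A *v u))) + Q *v (S *v (P *v u))"
      by (simp add: P_def Q_def lin flip: matrix_vector_mul_assoc)
    then show "S *v u = (A ** (G ** S) + Q ** S ** G ** A
      + (\<Sum>i\<in>Basis. Q ** E1 i ** G ** U i) + (\<Sum>i\<in>Basis. W i ** (G ** (E1 i ** P)))) *v u"
      unfolding QSP
      by (simp add: matrix_vector_mult_add_rdistrib matrix_vector_mult_sum_left matrix_vector_mul_assoc
          matrix_mul_assoc add.assoc)
  qed
  have "rank (Q ** E1 i ** G ** U i) \<le> rank A" for i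
    by (meson order_trans rank_G rank_mul_le_left rank_mul_le_right)
  then have 1: "rank (\<Sum>i\<in>Basis. Q ** E1 i ** G ** U i) \<le> DIM('a) * rank A"
    by (intro rank_sum_le)
  have "rank (W i ** (G ** (E1 i ** P))) \<le> rank A" for i
    by (meson order_trans rank_G rank_mul_le_left rank_mul_le_right)
  then have 2: "rank (\<Sum>i\<in>Basis. W i ** (G ** (E1 i ** P))) \<le> DIM('a) * rank A"
    by (intro rank_sum_le)
  have "rank S \<le> rank (A ** (G ** S)) + rank (Q ** S ** G ** A)
      + rank (\<Sum>i\<in>Basis. Q ** E1 i ** G ** U i) + rank (\<Sum>i\<in>Basis. W i ** (G ** (E1 i ** P)))"
    by (subst decomposition) (meson add_mono order_refl order_trans rank_add_le)
  also have "\<dots> \<le> rank A + rank A + DIM('a) * rank A + DIM('a) * rank A"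
    by (intro add_mono 1 2 rank_mul_le_left rank_mul_le_right)
  finally show ?thesis
    by (simp add: S_def A_def algebra_simps)
qed

section \<open>Trilinearity and the bound for rank-one tensors\<close>

lemma outer3_add:
  "outer3 (a + a') b c = outer3 a b c + outer3 a' b c"
  "outer3 a (b + b') c = outer3 a b c + outer3 a b' c"
  "outer3 a b (c + c') = outer3 a b c + outer3 a b c'"
  by (simp_all add: outer3_def vec_eq_iff algebra_simps)

lemma outer3_scaleR:
  "outer3 (t *\<^sub>R a) b c = t *\<^sub>R outer3 a b c"
  "outer3 a (t *\<^sub>R b) c = t *\<^sub>R outer3 a b c"
  "outer3 a b (t *\<^sub>R c) = t *\<^sub>R outer3 a b c"
  by (simp_all add: outer3_def vec_eq_iff)

lemma tensor_eq_sum_outer3: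
  fixes T :: "real ^ 'n3 ^ 'n2 ^ 'n1"
  shows "T = (\<Sum>i\<in>UNIV. \<Sum>j\<in>UNIV. \<Sum>k\<in>UNIV.
    T $ i $ j $ k *\<^sub>R outer3 (axis i 1) (axis j 1) (axis k 1))"
  by (simp add: vec_eq_iff outer3_def axis_def
      if_distrib [of "\<lambda>x. _ * x"] if_distrib [of "\<lambda>x. x * _"]
      cong: if_cong)

text \<open>Outer products of standard basis vectors span the tensors. This later excludes that the
  maximal rank is 0.\<close>

lemma linear_zero_if_zero_on_outer3:
  fixes M :: "real ^ 'n3 ^ 'n2 ^ 'n1 \<Rightarrow> 'b::real_vector"
  assumes "linear M" "\<And>a b c. M (outer3 a b c) = 0"
  shows "M T = 0"
  by (subst tensor_eq_sum_outer3) (simp add: assms linear_sum linear_scale)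

text \<open>A trilinear map expands around \<open>(a0, b0, c0)\<close> into parts of degree 0 to 3.
  The cubic part is the map itself, so \<open>X\<close> takes the role of \<open>E3\<close>.\<close>

lemma rank_sum_outer3_le:
  fixes M :: "real ^ 'n3 ^ 'n2 ^ 'n1 \<Rightarrow> real ^ 'N2 ^ 'N1"
  assumes M: "linear M"
    and rank: "\<And>a b c. \<forall>\<^sub>F t in at_right 0.
      rank (M (outer3 (a0 + t *\<^sub>R a) (b0 + t *\<^sub>R b) (c0 + t *\<^sub>R c))) \<le> rank (M (outer3 a0 b0 c0))"
  shows "rank (M (\<Sum>l\<in>L. outer3 (a l) (b l) (c l)))
    \<le> 2 * (CARD('n1) + CARD('n2) + CARD('n3) + 1) * rank (M (outer3 a0 b0 c0))"
proof -
  define X where "X = (\<lambda>(a, b, c). M (outer3 a b c))"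
  define E1 where "E1 = (\<lambda>(a, b, c). M (outer3 a b0 c0 + outer3 a0 b c0 + outer3 a0 b0 c))"
  define E2 where "E2 = (\<lambda>(a, b, c). M (outer3 a b c0 + outer3 a b0 c + outer3 a0 b c))"
  note lin = linear_add[OF M] linear_scale[OF M] outer3_add outer3_scaleR
  have "linear E1"
    by (rule linearI) (auto simp: E1_def lin algebra_simps)
  moreover have "X ((a0, b0, c0) + t *\<^sub>R y) =
      X (a0, b0, c0) + t *\<^sub>R (E1 y + t *\<^sub>R E2 y + t\<^sup>2 *\<^sub>R X y)" for t y
    by (cases y) (simp add: X_def E1_def E2_def lin algebra_simps power2_eq_square)
  moreover have "\<forall>\<^sub>F t in at_right 0. rank (X ((a0, b0, c0) + t *\<^sub>R y)) \<le> rank (X (a0, b0, c0))" for y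
    using rank by (cases y) (simp add: X_def)
  ultimately have "rank (\<Sum>l\<in>L. X (a l, b l, c l))
      \<le> 2 * (DIM((real ^ 'n1) \<times> (real ^ 'n2) \<times> (real ^ 'n3)) + 1) * rank (X (a0, b0, c0))"
    by (rule rank_sum_of_cubic_values_le)
  then show ?thesis
    by (simp add: X_def linear_sum[OF M] add.assoc)
qed

theorem theorem2p11:
  fixes M :: "real ^ 'n3 ^ 'n2 ^ 'n1 \<Rightarrow> real ^ 'N2 ^ 'N1"
    and l1 :: "'r::finite"
  assumes "linear M"
    and "\<exists>T. M T \<noteq> 0"
    and "generically (\<lambda>(a :: real ^ 'n1 ^ 'r, b :: real ^ 'n2 ^ 'r, c :: real ^ 'n3 ^ 'r).
           rank (M (\<Sum>l\<in>UNIV. outer3 (a $ l) (b $ l) (c $ l)))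
             = CARD('r) * rank (M (outer3 (a $ l1) (b $ l1) (c $ l1))))"
  shows "CARD('r) \<le> 2 * (CARD('n1) + CARD('n2) + CARD('n3) + 1)"
proof -
  obtain p :: "(real ^ 'n1 ^ 'r) \<times> (real ^ 'n2 ^ 'r) \<times> (real ^ 'n3 ^ 'r) \<Rightarrow> real"
    where p: "real_polynomial_function p" and nz: "\<exists>z. p z \<noteq> 0"
      and eq: "\<And>a b c. p (a, b, c) \<noteq> 0 \<Longrightarrow> rank (M (\<Sum>l\<in>UNIV. outer3 (a $ l) (b $ l) (c $ l)))
             = CARD('r) * rank (M (outer3 (a $ l1) (b $ l1) (c $ l1)))"
    using assms(3) unfolding generically_def by fastforce
  define R where "R = (\<lambda>(a :: real ^ 'n1 ^ 'r, b :: real ^ 'n2 ^ 'r, c :: real ^ 'n3 ^ 'r).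
    rank (M (outer3 (a $ l1) (b $ l1) (c $ l1))))"
  have "R z \<le> CARD('N1)" for z
    using rank_bound by (auto simp: R_def split: prod.split)
  \<comment> \<open>Ranks are bounded, so a maximum over the generic points exists. It is taken
    there because the rank identity must also hold at \<open>z\<close>.\<close>
  then have "\<exists>z. p z \<noteq> 0 \<and> (\<forall>z'. p z' \<noteq> 0 \<longrightarrow> R z' \<le> R z)"
    using nz ex_has_greatest_nat[of "\<lambda>z. p z \<noteq> 0" _ R "Suc CARD('N1)"] less_Suc_eq_le by blast
  then obtain z where z: "p z \<noteq> 0" and max: "\<And>z'. p z' \<noteq> 0 \<Longrightarrow> R z' \<le> R z"
    by blast
  obtain a b c where abc: "z = (a, b, c)"
    by (cases z)
  have bound: "rank (M (\<Sum>l\<in>L. outer3 (a' l) (b' l) (c' l)))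
      \<le> 2 * (CARD('n1) + CARD('n2) + CARD('n3) + 1) * R z" for L :: "'r set" and a' b' c'
  proof -
    have "\<forall>\<^sub>F t in at_right 0. rank (M (outer3 (a $ l1 + t *\<^sub>R u) (b $ l1 + t *\<^sub>R v) (c $ l1 + t *\<^sub>R w)))
        \<le> rank (M (outer3 (a $ l1) (b $ l1) (c $ l1)))" for u v w
    proof -
      \<comment> \<open>Only the components at \<open>l1\<close> move. By continuity
        \<open>p\<close> stays nonzero for small \<open>t\<close>, so the maximality of
        \<open>R z\<close> over generic points becomes local maximality in every direction.\<close>
      define d :: "(real ^ 'n1 ^ 'r) \<times> (real ^ 'n2 ^ 'r) \<times> (real ^ 'n3 ^ 'r)"
        where "d = (axis l1 u, axis l1 v, axis l1 w)"
      have "isCont p (z + 0 *\<^sub>R d)"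
        using p by (simp add: real_polynomial_function_eq continuous_polymonial_function)
      then have "isCont (\<lambda>t. p (z + t *\<^sub>R d)) 0"
        by (intro isCont_o2[where g = p and f = "\<lambda>t. z + t *\<^sub>R d"]) (intro continuous_intros)
      then have "((\<lambda>t. p (z + t *\<^sub>R d)) \<longlongrightarrow> p z) (at_right 0)"
        by (auto simp: isCont_def intro: tendsto_within_subset)
      then have "\<forall>\<^sub>F t in at_right 0. p (z + t *\<^sub>R d) \<noteq> 0"
        using z by (rule tendsto_imp_eventually_ne)
      then show ?thesis
      proof eventually_elim
        case (elim t)
        then show ?case
          using max[OF elim] by (simp add: R_def abc d_def)
      qed
    qed
    from rank_sum_outer3_le[OF assms(1) this] show ?thesis
      by (simp add: R_def abc)
  qed
  \<comment> \<open>Otherwise \<open>bound\<close> with a single summand makes \<open>M\<close>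
    vanish on all outer products, contradicting that \<open>M\<close> is not zero.\<close>
  have "R z \<noteq> 0"
  proof
    assume "R z = 0"
    then have "M (outer3 u v w) = 0" for u v w
      using bound[where L = "{l1}" and a' = "\<lambda>_. u" and b' = "\<lambda>_. v" and c' = "\<lambda>_. w"] by (simp add: rank_eq_0)
    then show False
      using assms(1,2) linear_zero_if_zero_on_outer3 by blast
  qed
  \<comment> \<open>At \<open>z\<close> itself the rank of the full sum is known from
    \<open>eq\<close>, and the positive \<open>R z\<close> then cancels.\<close>
  moreover have "CARD('r) * R z \<le> 2 * (CARD('n1) + CARD('n2) + CARD('n3) + 1) * R z"
    using bound[where L = UNIV and a' = "($) a" and b' = "($) b" and c' = "($) c"] eq[of a b c] z by (simp add: R_def abc)
  ultimately show ?thesis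
    unfolding mult_le_cancel2 by blast
qed

end
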